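(* Assume that the price function $P$ is Lipschitz continuous, that $(P(X_0)-c)h>(r+\delta)\alpha$, and that there exists a time $t_0\in[0,T]$ for which $$h\int_{t_0}^{T} e^{-(r+\delta)(s-t_0)}\big(P(X_0e^{-\delta s})-c\big)\,ds>\alpha .$$ Let $(X,u)$ be the unique solution on $[0,T]$ to $$\dot X_t=-\delta X_t+\frac1\beta (u_t-\alpha)^+,\qquad \dot u_t=(r+\delta)u_t-\big(P(X_t)-c\big)h,\qquad t\in[0,T],$$ with given $X_0\ge 0$ and $u_T=0$. Then there exists $T^\star\in(0,T)$ such that $u_t\ge\alpha$ for $t\le T^\star$ and $u_t\le\alpha$ for $t\ge T^\star$ ($t\in[0,T]$).
   Context: Constants: $T>0$, $\delta>0$, $r>0$, $\alpha>0$, $\beta>0$, $c>0$, $h\in[0,8760]$, and a given initial value $X_0\ge 0$. The price function $P:[0,\infty)\to\mathbb{R}$ is strictly decreasing. Notation: $y^+=\max(y,0)$. A solution is a pair of continuously differentiable functions $X:[0,T]\to[0,\infty)$, $u:[0,T]\to\mathbb{R}$ satisfying both equations and the boundary conditions; it exists and is unique when $P$ is Lipschitz. *)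

theory Defs
  imports "HOL-Analysis.Analysis"
begin

(* Derivatives are taken within S, so that they are one-sided at the end points of an
   interval; C1_differentiable_on of the library requires two-sided derivatives. *)
definition C1_within :: "real set \<Rightarrow> (real \<Rightarrow> real) \<Rightarrow> bool" where
  "C1_within S f \<longleftrightarrow>
     (\<exists>f'. (\<forall>t\<in>S. (f has_real_derivative f' t) (at t within S)) \<and> continuous_on S f')"

definition pos_part :: "real \<Rightarrow> real" where
  "pos_part y = max y 0"

(* The boundary value problem on [0,T]. Only the values of X and u on [0,T] and those of P
   on [0,\<infinity>) are relevant. *)
definition is_solution ::
  "real \<Rightarrow> real \<Rightarrow> real \<Rightarrow> real \<Rightarrow> real \<Rightarrow> real \<Rightarrow> real \<Rightarrow> (real \<Rightarrow> real) \<Rightarrow> real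
     \<Rightarrow> (real \<Rightarrow> real) \<Rightarrow> (real \<Rightarrow> real) \<Rightarrow> bool" where
  "is_solution T \<delta> r \<alpha> \<beta> c h P X\<^sub>0 X u \<longleftrightarrow>
     C1_within {0..T} X \<and> C1_within {0..T} u \<and>
     (\<forall>t\<in>{0..T}. 0 \<le> X t) \<and>
     (\<forall>t\<in>{0..T}.
        (X has_real_derivative (- \<delta> * X t + 1 / \<beta> * pos_part (u t - \<alpha>))) (at t within {0..T})) \<and>
     (\<forall>t\<in>{0..T}.
        (u has_real_derivative ((r + \<delta>) * u t - (P (X t) - c) * h)) (at t within {0..T})) \<and>
     X 0 = X\<^sub>0 \<and> u T = 0"

end

theory Submission
  imports Defs
begin

text \<open>
  Put \<open>k = r + \<delta>\<close>, \<open>v = u - \<alpha>\<close> and \<open>g = (P(X) - c) h - k \<alpha>\<close>, so that \<open>v' = k v - g\<close>; in discounted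
  form, \<open>(exp (-k t) v)' = - exp (-k t) g\<close>. The whole argument rests on one monotonicity: while
  \<open>v < 0\<close> nothing is invested, so \<open>X\<close> decays, \<open>P(X)\<close> rises, and hence \<open>g\<close> cannot decrease.

  This makes negativity of \<open>v\<close> irreversible. If \<open>v\<close> starts nonnegative and is negative at \<open>s\<close>, then
  \<open>g s\<close> cannot be negative: otherwise \<open>g\<close> would have been negative ever since the last time at which
  \<open>v\<close> was nonnegative, and the discounted \<open>v\<close> would have increased from there on
  (\<open>forcing_nonneg_where_neg\<close>). From \<open>v s < 0\<close> and \<open>g s \<ge> 0\<close> on, \<open>g\<close> stays nonnegative as long as \<open>v\<close>
  is negative, so the discounted \<open>v\<close> keeps decreasing and never returns to zero (\<open>neg_persists\<close>).
  Thus the set where \<open>v\<close> is nonnegative is an initial segment, and \<open>T\<^sup>*\<close> is its last element; it is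
  less than \<open>T\<close> because \<open>v T = -\<alpha> < 0\<close>.

  It remains to see that \<open>v 0 > 0\<close>. By the first price hypothesis \<open>g 0 > 0\<close>, so if \<open>v 0 \<le> 0\<close> then \<open>v\<close>
  becomes negative at once, and irreversibly so. Then \<open>X\<close> is the pure decay \<open>X\<^sub>0 exp (-\<delta> t)\<close>, and
  integrating the discounted equation for \<open>u\<close> from \<open>t\<^sub>0\<close> to \<open>T\<close> shows that the quantity assumed to
  exceed \<open>\<alpha>\<close> in the second price hypothesis is \<open>u t\<^sub>0 \<le> \<alpha>\<close>, a contradiction.
\<close>

section \<open>A linear equation whose forcing grows on the negative regime\<close>

lemma has_real_derivative_discounted:
  assumes "(v has_real_derivative k * v t - q) (at t within S)"
  shows "((\<lambda>t. exp (- k * (t - a)) * v t) has_real_derivative - exp (- k * (t - a)) * q)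
           (at t within S)"
  by (rule derivative_eq_intros assms refl | simp add: algebra_simps)+

locale forced_linear_equation =
  fixes T k :: real and v g :: "real \<Rightarrow> real"
  assumes has_derivative:
      "t \<in> {0..T} \<Longrightarrow> (v has_real_derivative k * v t - g t) (at t within {0..T})"
    and forcing_mono:
      "\<lbrakk>0 \<le> a; a \<le> b; b \<le> T; \<And>t. t \<in> {a..b} \<Longrightarrow> v t < 0\<rbrakk> \<Longrightarrow> g a \<le> g b"
begin

definition discounted :: "real \<Rightarrow> real" where
  "discounted t = exp (- k * t) * v t"

lemma sgn_discounted: "sgn (discounted t) = sgn (v t)"
  by (simp add: discounted_def sgn_mult)

lemma discounted_neg_iff: "discounted t < 0 \<longleftrightarrow> v t < 0"
  and discounted_nonneg_iff: "discounted t \<ge> 0 \<longleftrightarrow> v t \<ge> 0"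
  using sgn_discounted[of t] by (auto simp: sgn_if split: if_splits)

lemma discounted_has_derivative:
  assumes "t \<in> {0..T}"
  shows "(discounted has_real_derivative - exp (- k * t) * g t) (at t within {0..T})"
  using has_real_derivative_discounted[OF has_derivative[OF assms], of 0]
  by (simp add: discounted_def[abs_def])

lemma discounted_has_derivative_interior:
  assumes "0 < t" "t < T"
  shows "(discounted has_real_derivative - exp (- k * t) * g t) (at t)"
  using discounted_has_derivative[of t] assms by (simp add: at_within_Icc_at)

lemma continuous_v: "continuous_on {0..T} v"
  using has_derivative by (rule DERIV_continuous_on)

lemma continuous_discounted: "continuous_on {0..T} discounted"
  using discounted_has_derivative by (rule DERIV_continuous_on)

lemma compact_nonneg:
  assumes "0 \<le> a" "b \<le> T"
  shows "compact {t \<in> {a..b}. 0 \<le> v t}"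
proof -
  have "closed {t \<in> {a..b}. 0 \<le> v t}"
    using assms
    by (intro continuous_on_closed_Collect_le continuous_on_const
          continuous_on_subset[OF continuous_v]) auto
  moreover have "bounded {t \<in> {a..b}. 0 \<le> v t}"
    by (rule bounded_subset[of "{a..b}"]) auto
  ultimately show ?thesis
    by (simp add: compact_eq_bounded_closed)
qed

text \<open>At the first return \<open>b\<close> to nonnegative values, the forcing would have been nonnegative
  from \<open>s\<close> until \<open>b\<close>, so the discounted solution could not have risen to zero.\<close>

lemma neg_persists_if_forcing_nonneg:
  assumes "0 \<le> s" "s \<le> t" "t \<le> T" "v s < 0" "g s \<ge> 0"
  shows "v t < 0"
proof (rule ccontr)
  assume "\<not> v t < 0"
  then have "{x \<in> {s..t}. 0 \<le> v x} \<noteq> {}"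
    using assms by auto
  then obtain b where b: "b \<in> {s..t}" "0 \<le> v b"
    and first: "\<And>x. x \<in> {s..t} \<Longrightarrow> 0 \<le> v x \<Longrightarrow> b \<le> x"
    using compact_attains_inf[OF compact_nonneg[of s t]] assms by auto
  have neg: "v x < 0" if "s \<le> x" "x < b" for x
    using first[of x] that b by force
  have "discounted b \<le> discounted s"
  proof (rule DERIV_nonpos_imp_decreasing_open[where f = discounted])
    fix x assume x: "s < x" "x < b"
    have "g s \<le> g x"
      using x b assms neg by (intro forcing_mono) auto
    with assms(5) have "- exp (- k * x) * g x \<le> 0"
      by simp
    moreover have "0 < x" "x < T"
      using x b assms by auto
    ultimately show "\<exists>y. (discounted has_real_derivative y) (at x) \<and> y \<le> 0"
      using discounted_has_derivative_interior[of x] by blast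
  qed (use b assms in \<open>auto intro: continuous_on_subset[OF continuous_discounted]\<close>)
  then show False
    using assms(4) b(2) discounted_neg_iff[of s] discounted_nonneg_iff[of b] by linarith
qed

text \<open>A negative forcing at \<open>s\<close> would be negative all the way back to the last time \<open>a\<close> with
  \<open>v a \<ge> 0\<close>, so the discounted solution could not have fallen below zero between \<open>a\<close> and \<open>s\<close>.\<close>

lemma forcing_nonneg_where_neg:
  assumes "0 \<le> v 0" "0 \<le> s" "s \<le> T" "v s < 0"
  shows "g s \<ge> 0"
proof (rule ccontr)
  assume "\<not> g s \<ge> 0"
  then have gs: "g s < 0" by simp
  have "{x \<in> {0..s}. 0 \<le> v x} \<noteq> {}"
    using assms by auto
  then obtain a where a: "a \<in> {0..s}" "0 \<le> v a"
    and last: "\<And>x. x \<in> {0..s} \<Longrightarrow> 0 \<le> v x \<Longrightarrow> x \<le> a"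
    using compact_attains_sup[OF compact_nonneg[of 0 s]] assms by auto
  have neg: "v x < 0" if "a < x" "x \<le> s" for x
    using last[of x] that a by force
  have "discounted a \<le> discounted s"
  proof (rule DERIV_nonneg_imp_increasing_open[where f = discounted])
    fix x assume x: "a < x" "x < s"
    have "g x \<le> g s"
      using x a assms neg by (intro forcing_mono) auto
    with gs have "g x \<le> 0" by simp
    then have "0 \<le> - exp (- k * x) * g x"
      by (simp add: mult_nonneg_nonpos)
    moreover have "0 < x" "x < T"
      using x a assms by auto
    ultimately show "\<exists>y. (discounted has_real_derivative y) (at x) \<and> 0 \<le> y"
      using discounted_has_derivative_interior[of x] by blast
  qed (use a assms in \<open>auto intro: continuous_on_subset[OF continuous_discounted]\<close>)
  then show False
    using assms(4) a(2) discounted_neg_iff[of s] discounted_nonneg_iff[of a] by linarith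
qed

lemma neg_persists:
  assumes "0 \<le> v 0" "0 \<le> s" "s \<le> t" "t \<le> T" "v s < 0"
  shows "v t < 0"
  using assms forcing_nonneg_where_neg[of s] neg_persists_if_forcing_nonneg[of s t] by simp

lemma nonpos_if_initially_nonpos:
  assumes "v 0 \<le> 0" "g 0 > 0" "t \<in> {0..T}"
  shows "v t \<le> 0"
proof (cases "v 0 = 0")
  case False
  then show ?thesis
    using assms neg_persists_if_forcing_nonneg[of 0 t] by auto
next
  case True
  show ?thesis
  proof (cases "t = 0")
    case True
    with assms show ?thesis by simp
  next
    case False
    with assms have t: "0 < t" "t \<le> T" by auto
    \<comment> \<open>The slope at \<open>0\<close> is \<open>- g 0 < 0\<close>, so \<open>v\<close> is negative at some time before \<open>t\<close>.\<close>
    have "(v has_real_derivative - g 0) (at 0 within {0..T})"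
      using has_derivative[of 0] t True by simp
    then obtain d where d: "d > 0" "\<And>e. e > 0 \<Longrightarrow> e \<in> {0..T} \<Longrightarrow> e < d \<Longrightarrow> v e < 0"
      using has_real_derivative_neg_dec_right[of v "- g 0" 0 "{0..T}"] assms True by auto
    define s where "s = min t (d / 2)"
    have "0 < s" "s \<le> t" "s < d"
      using t d by (auto simp: s_def)
    with t d(2)[of s] have "v t < 0"
      using True by (intro neg_persists[of s t]) auto
    then show ?thesis by simp
  qed
qed

lemma single_sign_change:
  assumes "0 < T" "0 < v 0" "v T < 0"
  shows "\<exists>z\<in>{0<..<T}. \<forall>t\<in>{0..T}. (t \<le> z \<longrightarrow> 0 \<le> v t) \<and> (z \<le> t \<longrightarrow> v t \<le> 0)"
proof -
  have "0 \<in> {x \<in> {0..T}. 0 \<le> v x}"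
    using assms by simp
  then have "{x \<in> {0..T}. 0 \<le> v x} \<noteq> {}" by blast
  then obtain z where z: "z \<in> {0..T}" "0 \<le> v z"
    and last: "\<And>x. x \<in> {0..T} \<Longrightarrow> 0 \<le> v x \<Longrightarrow> x \<le> z"
    using compact_attains_sup[OF compact_nonneg[of 0 T]] by auto
  \<comment> \<open>\<open>v\<close> has a zero in \<open>[z, T]\<close>, and being maximal \<open>z\<close> must be that zero.\<close>
  obtain y where y: "z \<le> y" "y \<le> T" "v y = 0"
    using IVT2'[of v T 0 z] z assms continuous_on_subset[OF continuous_v, of "{z..T}"] by auto
  then have "y = z"
    using last[of y] z by auto
  with y have vz: "v z = 0" by simp
  then have "z \<in> {0<..<T}"
    using z assms by (cases "z = 0"; cases "z = T") auto
  moreover have "0 \<le> v t" if "t \<in> {0..T}" "t \<le> z" for t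
    using neg_persists[of t z] that z assms(2) vz by force
  moreover have "v t \<le> 0" if "t \<in> {0..T}" "z \<le> t" for t
    using last[of t] that vz by force
  ultimately show ?thesis by blast
qed

end

section \<open>Exponential decay and discounted values\<close>

lemma exponential_decay:
  fixes X :: "real \<Rightarrow> real"
  assumes "\<And>t. t \<in> {0..T} \<Longrightarrow> (X has_real_derivative - \<delta> * X t) (at t within {0..T})"
    and "t \<in> {0..T}"
  shows "X t = X 0 * exp (- \<delta> * t)"
proof -
  have "((\<lambda>t. exp (\<delta> * t) * X t) has_real_derivative 0) (at t within {0..T})"
    if "t \<in> {0..T}" for t
    using has_real_derivative_discounted[of X "- \<delta>" t 0 "{0..T}" 0] assms(1)[OF that] by simp
  then have "\<exists>C. \<forall>t\<in>{0..T}. exp (\<delta> * t) * X t = C"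
    by (intro has_field_derivative_zero_constant) auto
  then obtain C where C: "\<And>t. t \<in> {0..T} \<Longrightarrow> exp (\<delta> * t) * X t = C" by blast
  have "exp (\<delta> * t) * X t = X 0"
    using C[of t] C[of 0] assms(2) by simp
  then show ?thesis
    by (auto simp: exp_minus field_simps)
qed

text \<open>With zero terminal value, \<open>u a\<close> is the discounted future yield: integrate the derivative of the
  discounted \<open>u\<close> over \<open>[a, T]\<close>.\<close>

lemma terminal_value_formula:
  fixes u p :: "real \<Rightarrow> real"
  assumes deriv: "\<And>t. t \<in> {a..T} \<Longrightarrow> (u has_real_derivative k * u t - p t) (at t within {a..T})"
    and "a \<le> T" "u T = 0"
  shows "integral {a..T} (\<lambda>s. exp (- k * (s - a)) * p s) = u a"
proof -
  have "((\<lambda>s. - exp (- k * (s - a)) * p s) has_integral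
          exp (- k * (T - a)) * u T - exp (- k * (a - a)) * u a) {a..T}"
    using has_real_derivative_discounted[OF deriv] assms(2)
    by (intro fundamental_theorem_of_calculus)
       (auto simp: has_real_derivative_iff_has_vector_derivative)
  then have "((\<lambda>s. exp (- k * (s - a)) * p s) has_integral u a) {a..T}"
    using assms(3) by (auto dest: has_integral_neg)
  then show ?thesis by (rule integral_unique)
qed

section \<open>The investment problem\<close>

theorem lemma3p3:
  fixes T \<delta> r \<alpha> \<beta> c h X\<^sub>0 :: real
    and P X u :: "real \<Rightarrow> real"
  assumes "T > 0" and "\<delta> > 0" and "r > 0" and "\<alpha> > 0" and "\<beta> > 0" and "c > 0"
    and "h \<in> {0..8760}" and "X\<^sub>0 \<ge> 0"
    and "strict_antimono_on {0..} P"
    and "\<exists>L. L-lipschitz_on {0..} P"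
    and "(P X\<^sub>0 - c) * h > (r + \<delta>) * \<alpha>"
    and "\<exists>t\<^sub>0\<in>{0..T}.
           h * integral {t\<^sub>0..T}
                 (\<lambda>s. exp (- (r + \<delta>) * (s - t\<^sub>0)) * (P (X\<^sub>0 * exp (- \<delta> * s)) - c)) > \<alpha>"
    and "is_solution T \<delta> r \<alpha> \<beta> c h P X\<^sub>0 X u"
  shows "\<exists>T\<^sub>s\<in>{0<..<T}.
           (\<forall>t\<in>{0..T}. (t \<le> T\<^sub>s \<longrightarrow> u t \<ge> \<alpha>) \<and> (t \<ge> T\<^sub>s \<longrightarrow> u t \<le> \<alpha>))"
proof -
  define v where "v t = u t - \<alpha>" for t
  define g where "g t = (P (X t) - c) * h - (r + \<delta>) * \<alpha>" for t
  have X_nonneg: "0 \<le> X t" if "t \<in> {0..T}" for t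
    using assms(13) that by (auto simp: is_solution_def)
  have X_deriv: "(X has_real_derivative (- \<delta> * X t + 1 / \<beta> * pos_part (u t - \<alpha>)))
                   (at t within {0..T})" if "t \<in> {0..T}" for t
    using assms(13) that by (auto simp: is_solution_def)
  have u_deriv: "(u has_real_derivative (r + \<delta>) * u t - (P (X t) - c) * h) (at t within {0..T})"
    if "t \<in> {0..T}" for t
    using assms(13) that by (auto simp: is_solution_def)
  have X0: "X 0 = X\<^sub>0" and uT: "u T = 0"
    using assms(13) by (auto simp: is_solution_def)
  have X_decay: "(X has_real_derivative - \<delta> * X t) (at t within {0..T})"
    if "t \<in> {0..T}" "v t \<le> 0" for t
    using X_deriv[OF that(1)] that(2) by (simp add: v_def pos_part_def)

  interpret forced_linear_equation T "r + \<delta>" v g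
  proof
    show "(v has_real_derivative (r + \<delta>) * v t - g t) (at t within {0..T})" if "t \<in> {0..T}" for t
      unfolding v_def g_def
      by (rule derivative_eq_intros u_deriv[OF that] refl | simp add: algebra_simps)+
    show "g a \<le> g b" if ab: "0 \<le> a" "a \<le> b" "b \<le> T" and neg: "\<And>t. t \<in> {a..b} \<Longrightarrow> v t < 0" for a b
    proof -
      have "X b \<le> X a"
      proof (rule DERIV_nonpos_imp_decreasing_open[OF ab(2)])
        fix x assume x: "a < x" "x < b"
        then have "(X has_real_derivative - \<delta> * X x) (at x)"
          using X_decay[of x] neg[of x] ab by (simp add: at_within_Icc_at)
        moreover have "- \<delta> * X x \<le> 0"
          using X_nonneg[of x] x ab assms(2) by simp
        ultimately show "\<exists>y. (X has_real_derivative y) (at x) \<and> y \<le> 0" by blast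
      qed (use ab in \<open>auto intro: continuous_on_subset[OF DERIV_continuous_on[OF X_deriv]]\<close>)
      then have "P (X a) \<le> P (X b)"
        using monotone_onD[OF assms(9), of "X b" "X a"] X_nonneg[of a] X_nonneg[of b] ab
        by (cases "X a = X b") auto
      then show ?thesis
        using assms(7) by (simp add: g_def mult_right_mono)
    qed
  qed

  have "0 < v 0"
  proof (rule ccontr)
    assume "\<not> 0 < v 0"
    moreover have "g 0 > 0"
      using assms(11) by (simp add: g_def X0)
    ultimately have nonpos: "v t \<le> 0" if "t \<in> {0..T}" for t
      using nonpos_if_initially_nonpos[of t] that by simp
    have X_eq: "X t = X\<^sub>0 * exp (- \<delta> * t)" if "t \<in> {0..T}" for t
      using exponential_decay[of T X \<delta> t] X_decay nonpos that X0 by simp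
    obtain t\<^sub>0 where t0: "t\<^sub>0 \<in> {0..T}"
      and gain: "h * integral {t\<^sub>0..T}
                 (\<lambda>s. exp (- (r + \<delta>) * (s - t\<^sub>0)) * (P (X\<^sub>0 * exp (- \<delta> * s)) - c)) > \<alpha>"
      using assms(12) by blast
    have "u t\<^sub>0 = integral {t\<^sub>0..T} (\<lambda>s. exp (- (r + \<delta>) * (s - t\<^sub>0)) * ((P (X s) - c) * h))"
      using t0 uT
      by (intro terminal_value_formula[symmetric] DERIV_subset[OF u_deriv]) auto
    also have "\<dots> = integral {t\<^sub>0..T}
        (\<lambda>s. h * (exp (- (r + \<delta>) * (s - t\<^sub>0)) * (P (X\<^sub>0 * exp (- \<delta> * s)) - c)))"
      using t0 by (intro integral_cong) (simp add: X_eq)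
    also have "\<dots> = h * integral {t\<^sub>0..T}
        (\<lambda>s. exp (- (r + \<delta>) * (s - t\<^sub>0)) * (P (X\<^sub>0 * exp (- \<delta> * s)) - c))"
      by (rule integral_mult_right)
    finally have "u t\<^sub>0 > \<alpha>"
      using gain by simp
    with nonpos[OF t0] show False
      by (simp add: v_def)
  qed
  moreover have "v T < 0"
    using uT assms(4) by (simp add: v_def)
  ultimately show ?thesis
    using single_sign_change assms(1) by (simp add: v_def)
qed

end
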